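(* Let $A\in[0,1]^{n\times n}$ and $\lambda\in[0,1]$. Call $x\in[0,1]^n$ a pure Łukasiewicz eigenvector of $A$ associated with $\lambda$ if $A\otimes_L x=\lambda\otimes_L x$ and $x_i\ge 1-\lambda$ for all $i$. Then $A$ has a pure Łukasiewicz eigenvector associated with $\lambda$ if and only if $\rho(A)\le\lambda$ and $\max_i\big((A^{(\lambda)})^*\otimes \mathbf{0}\big)_i\le\lambda$. Moreover (with $\rho(A)\le\lambda$, so that $(A^{(\lambda)})^*$ is defined), a vector $x\in\mathbb{R}^n$ is a pure Łukasiewicz eigenvector associated with $\lambda$ if and only if $$x=(A^{(\lambda)})^*\otimes\big(((1-\lambda)\otimes\mathbf{0})\oplus z\big)$$ for some vector $z\in(\mathbb{R}\cup\{-\infty\})^n$ satisfying $z\le \big((A^{(\lambda)})^*\big)^{\sharp}\otimes'\mathbf{1}$ and $z_i=-\infty$ for all $i\notin\tilde N_C(A,\lambda)$. In particular, $z$ is the all-$(-\infty)$ vector whenever $\lambda\neq\rho(A)$.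
   Context: Max-Łukasiewicz arithmetic on $[0,1]$: $a\oplus b=\max(a,b)$, $a\otimes_L b=\max(0,a+b-1)$; $(A\otimes_L x)_i=\max_j\max(0,a_{ij}+x_j-1)$, $(\lambda\otimes_L x)_i=\max(0,\lambda+x_i-1)$. Tropical (max-plus) arithmetic on $\mathbb{R}\cup\{-\infty\}$: $a\oplus b=\max(a,b)$, $a\otimes b=a+b$, $(A\otimes B)_{ik}=\max_j(a_{ij}+b_{jk})$; min-plus product $(A\otimes' B)_{ik}=\min_j(a_{ij}+b_{jk})$; $A^\sharp$ is the matrix with $(A^\sharp)_{ij}=-a_{ji}$; for a scalar $\alpha$, $\alpha\otimes v$ adds $\alpha$ to every component. $\mathbf{0}$ and $\mathbf{1}$ are the all-zero and all-one vectors. For $\alpha\in\mathbb{R}$, $A^{(\alpha)}$ is the matrix with entries $a_{ij}-\alpha$. $\rho(A)$ is the maximum cycle mean, $\max_{k}\max_{i_1,\dots,i_k}(a_{i_1i_2}+\dots+a_{i_ki_1})/k$. The Kleene star of a matrix $B$ with $\rho(B)\le 0$ is $B^*=I\oplus B\oplus B^2\oplus\cdots=I\oplus B\oplus\dots\oplus B^{n-1}$ (tropical powers), where $I$ has $0$ on the diagonal and $-\infty$ off it. The critical graph of $A$ consists of the nodes and edges of the digraph of $A$ (nodes $1,\dots,n$, edge $(i,j)$ of weight $a_{ij}$) lying on cycles whose mean equals $\rho(A)$. $\tilde N_C(A,\lambda)$ is empty if $\lambda\neq\rho(A)$; if $\lambda=\rho(A)$ it is a set of indices containing exactly one (arbitrarily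 chosen) node from each strongly connected component of the critical graph of $A$. *)

theory Defs
  imports "HOL-Analysis.Analysis" "Graph_Theory.Digraph_Component"
begin

section \<open>Max-Lukasiewicz arithmetic\<close>

definition luk_mult :: "real \<Rightarrow> real \<Rightarrow> real" where
  "luk_mult a b = max 0 (a + b - 1)"

definition luk_mat_vec :: "real^'n^'m \<Rightarrow> real^'n \<Rightarrow> real^'m" where
  "luk_mat_vec A x = (\<chi> i. MAX j. luk_mult (A $ i $ j) (x $ j))"

definition luk_scal_vec :: "real \<Rightarrow> real^'n \<Rightarrow> real^'n" where
  "luk_scal_vec l x = (\<chi> i. luk_mult l (x $ i))"

definition pure_luk_eigenvector :: "real^'n^'n \<Rightarrow> real \<Rightarrow> real^'n \<Rightarrow> bool" where
  "pure_luk_eigenvector A l x \<longleftrightarrow>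
     (\<forall>i. 0 \<le> x $ i \<and> x $ i \<le> 1) \<and>
     luk_mat_vec A x = luk_scal_vec l x \<and>
     (\<forall>i. x $ i \<ge> 1 - l)"

section \<open>Max-plus and min-plus arithmetic\<close>

text \<open>
  The tropical semiring on the reals with minus infinity is embedded into \<^typ>\<open>ereal\<close>; plus
  infinity is needed for the entries of \<open>mp_sharp B\<close>.  In \<^typ>\<open>ereal\<close> one has
  \<open>\<infinity> + -\<infinity> = \<infinity>\<close>, but no such sum arises for the matrices of interest: all
  entries of the Kleene star of a finite matrix with nonpositive maximum cycle mean are finite.
\<close>

definition ereal_vec :: "real^'n \<Rightarrow> ereal^'n" where
  "ereal_vec x = (\<chi> i. ereal (x $ i))"

definition mp_one :: "ereal^'n^'n" where
  "mp_one = (\<chi> i j. if i = j then 0 else -\<infinity>)"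

definition mp_mult :: "ereal^'k^'m \<Rightarrow> ereal^'n^'k \<Rightarrow> ereal^'n^'m" where
  "mp_mult A B = (\<chi> i k. MAX j. A $ i $ j + B $ j $ k)"

definition mp_mat_vec :: "ereal^'n^'m \<Rightarrow> ereal^'n \<Rightarrow> ereal^'m" where
  "mp_mat_vec A x = (\<chi> i. MAX j. A $ i $ j + x $ j)"

definition mp_add_vec :: "ereal^'n \<Rightarrow> ereal^'n \<Rightarrow> ereal^'n" where
  "mp_add_vec x y = (\<chi> i. max (x $ i) (y $ i))"

definition mp_scal_vec :: "ereal \<Rightarrow> ereal^'n \<Rightarrow> ereal^'n" where
  "mp_scal_vec a x = (\<chi> i. a + x $ i)"

primrec mp_pow :: "ereal^'n^'n \<Rightarrow> nat \<Rightarrow> ereal^'n^'n" where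
  "mp_pow B 0 = mp_one"
| "mp_pow B (Suc k) = mp_mult (mp_pow B k) B"

definition mp_star :: "ereal^'n^'n \<Rightarrow> ereal^'n^'n" where
  "mp_star B = (\<chi> i j. SUP k. mp_pow B k $ i $ j)"

definition mp_sharp :: "ereal^'n^'m \<Rightarrow> ereal^'m^'n" where
  "mp_sharp A = (\<chi> i j. - A $ j $ i)"

definition minplus_mat_vec :: "ereal^'n^'m \<Rightarrow> ereal^'n \<Rightarrow> ereal^'m" where
  "minplus_mat_vec A x = (\<chi> i. MIN j. A $ i $ j + x $ j)"

definition shift_mat :: "real^'n^'n \<Rightarrow> real \<Rightarrow> ereal^'n^'n" where
  "shift_mat A a = (\<chi> i j. ereal (A $ i $ j - a))"

section \<open>Maximum cycle mean and critical graph\<close>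

text \<open>
  A cycle is given by a nonempty list of nodes \<open>[i1, \<dots>, ik]\<close> (repetitions allowed)
  and has the edges \<open>(i1, i2), \<dots>, (ik, i1)\<close>; the list \<open>[i]\<close> is the loop
  at \<open>i\<close>.  All entries of the matrix are finite, so its digraph is complete.
\<close>

definition cycle_edges :: "'n list \<Rightarrow> ('n \<times> 'n) list" where
  "cycle_edges c = zip c (rotate1 c)"

definition cycle_mean :: "real^'n^'n \<Rightarrow> 'n list \<Rightarrow> real" where
  "cycle_mean A c = (\<Sum>(i, j)\<leftarrow>cycle_edges c. A $ i $ j) / real (length c)"

text \<open>
  The set of cycle means is bounded (\<open>bdd_above_cycle_mean\<close> below), and its supremum is
  attained at a cycle without repeated nodes, so it is the maximum.
\<close>

definition max_cycle_mean :: "real^'n^'n \<Rightarrow> real" where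
  "max_cycle_mean A = (SUP c\<in>{c. c \<noteq> []}. cycle_mean A c)"

lemma bdd_above_cycle_mean:
  fixes A :: "real^'n^'n"
  shows "bdd_above (cycle_mean A ` {c. c \<noteq> []})"
proof (rule bdd_aboveI2)
  fix c :: "'n list" assume c: "c \<in> {c. c \<noteq> []}"
  define M where "M = (MAX p. A $ fst p $ snd p)"
  have entry: "A $ fst p $ snd p \<le> M" for p :: "'n \<times> 'n"
    unfolding M_def by (rule Max_ge) auto
  have "(\<Sum>(i, j)\<leftarrow>xs. A $ i $ j) \<le> real (length xs) * M" for xs :: "('n \<times> 'n) list"
  proof (induction xs)
    case (Cons p xs)
    then show ?case
      using add_mono[OF entry[of p] Cons.IH]
      by (simp add: algebra_simps split_beta)
  qed simp
  from this[of "cycle_edges c"] show "cycle_mean A c \<le> M"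
    using c by (simp add: cycle_mean_def cycle_edges_def field_simps)
qed

definition critical_cycle :: "real^'n^'n \<Rightarrow> 'n list \<Rightarrow> bool" where
  "critical_cycle A c \<longleftrightarrow> c \<noteq> [] \<and> cycle_mean A c = max_cycle_mean A"

definition critical_graph :: "real^'n^'n \<Rightarrow> 'n pair_pre_digraph" where
  "critical_graph A =
     \<lparr> pverts = {i. \<exists>c. critical_cycle A c \<and> i \<in> set c},
       parcs = {e. \<exists>c. critical_cycle A c \<and> e \<in> set (cycle_edges c)} \<rparr>"

text \<open>
  The set \<open>N\<close> of representatives is not unique; the predicate holds for every admissible choice.
\<close>

definition is_NC :: "real^'n^'n \<Rightarrow> real \<Rightarrow> 'n set \<Rightarrow> bool" where
  "is_NC A l N \<longleftrightarrow>
     (if l = max_cycle_mean A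
      then N \<subseteq> pverts (critical_graph A) \<and>
           (\<forall>S \<in> pre_digraph.sccs_verts (with_proj (critical_graph A)). \<exists>!i. i \<in> N \<inter> S)
      else N = {})"

end

theory Submission
  imports Defs
begin

text \<open>
  For vectors bounded below by \<open>1 - \<lambda>\<close> the Lukasiewicz truncations can be removed, and the
  eigenvector equation becomes the max-plus affine equation
  \<open>x = (A - \<lambda>) \<otimes> x \<oplus> (1 - \<lambda>)\<close> together with \<open>x \<le> 1\<close>.  Following, from any node, an edge that
  attains the maximum, one either stops at a component equal to \<open>1 - \<lambda>\<close> or runs into a cycle of mean
  \<open>\<lambda>\<close>; so \<open>x\<close> is spanned by \<open>1 - \<lambda>\<close> and its own values at critical nodes.  Nodes in the same
  component of the critical graph give proportional columns of the Kleene star, so that one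
  representative of each suffices.  Since the entries of \<open>A\<close> are nonnegative, closing up walks shows
  that the star is bounded by \<open>\<lambda>\<close>: the second existence condition follows from the first.
\<close>

section \<open>Walks and the Kleene star of a real matrix\<close>

text \<open>A walk is its list of nodes: a single node is the edgeless walk of weight 0, and a
  closed walk repeats its first node at the end.\<close>

fun walk_weight :: "real^'n^'n \<Rightarrow> 'n list \<Rightarrow> real" where
  "walk_weight B (x # y # ys) = B $ x $ y + walk_weight B (y # ys)"
| "walk_weight B _ = 0"

definition walks :: "'n \<Rightarrow> 'n \<Rightarrow> 'n list set" where
  "walks i j = {p. p \<noteq> [] \<and> hd p = i \<and> last p = j}"

lemma walk_weight_append:
  "walk_weight B (ps @ x # qs) = walk_weight B (ps @ [x]) + walk_weight B (x # qs)"
proof (induction ps)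
  case (Cons a ps)
  then show ?case by (cases ps) auto
qed simp

text \<open>\<open>length p - 1\<close> counts the edges; truncated subtraction makes it 0 for the
  empty list.\<close>

lemma walk_weight_minus_const:
  "walk_weight (\<chi> i j. A $ i $ j - a) p = walk_weight A p - a * real (length p - 1)"
  by (induction "A" p rule: walk_weight.induct) (auto simp: algebra_simps)

text \<open>\<open>x\<close> acts as a potential: the edge inequalities telescope along the
  walk.\<close>

lemma walk_weight_le_of_edges_le:
  assumes edge: "\<And>i j. B $ i $ j + x j \<le> x i" and "p \<noteq> []"
  shows "walk_weight B p + x (last p) \<le> x (hd p)"
  using \<open>p \<noteq> []\<close>
proof (induction p rule: induct_list012)
  case (3 u v ys)
  then show ?case using edge[of u v] by auto
qed auto

lemma sum_list_zip_eq_walk_weight: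
  "(\<Sum>(i, j)\<leftarrow>zip (x # xs) (xs @ [y]). A $ i $ j) = walk_weight A (x # xs @ [y])"
  by (induction xs arbitrary: x) auto

lemma sum_list_cycle_edges:
  "(\<Sum>(i, j)\<leftarrow>cycle_edges (x # xs). A $ i $ j) = walk_weight A (x # xs @ [x])"
  unfolding cycle_edges_def using sum_list_zip_eq_walk_weight[where x = x and y = x and A = A]
  by simp

text \<open>A cycle listed with k nodes has k edges, so subtracting \<open>l\<close> from every
  entry lowers its weight by k times \<open>l\<close>; the sign of the new weight compares the mean
  with \<open>l\<close>.\<close>

lemma cycle_mean_le_iff:
  "cycle_mean A (x # xs) \<le> l \<longleftrightarrow> walk_weight (\<chi> i j. A $ i $ j - l) (x # xs @ [x]) \<le> 0"
  by (simp add: cycle_mean_def sum_list_cycle_edges walk_weight_minus_const field_simps)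

lemma cycle_mean_eq_iff:
  "cycle_mean A (x # xs) = l \<longleftrightarrow> walk_weight (\<chi> i j. A $ i $ j - l) (x # xs @ [x]) = 0"
  by (simp add: cycle_mean_def sum_list_cycle_edges walk_weight_minus_const field_simps)

lemma max_cycle_mean_le_iff:
  "max_cycle_mean A \<le> l \<longleftrightarrow>
     (\<forall>x xs. walk_weight (\<chi> i j. A $ i $ j - l) (x # xs @ [x]) \<le> 0)"
proof -
  have "max_cycle_mean A \<le> l \<longleftrightarrow> (\<forall>c\<in>{c. c \<noteq> []}. cycle_mean A c \<le> l)"
    unfolding max_cycle_mean_def
    by (rule cSUP_le_iff[OF _ bdd_above_cycle_mean]) auto
  also have "\<dots> \<longleftrightarrow> (\<forall>x xs. cycle_mean A (x # xs) \<le> l)"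
    by (auto simp: neq_Nil_conv)
  finally show ?thesis
    unfolding cycle_mean_le_iff .
qed

text \<open>Zipping a walk with its own shift lists its edges, so each edge found there is a place
  where the walk can be cut.\<close>

lemma in_zip_shift_split:
  assumes "(i, j) \<in> set (zip (x # xs) (xs @ [y]))"
  shows "\<exists>ps qs. x # xs @ [y] = ps @ i # j # qs"
  using assms
proof (induction xs arbitrary: x)
  case (Cons a xs)
  then consider "i = x" "j = a" | "(i, j) \<in> set (zip (a # xs) (xs @ [y]))" by auto
  then show ?case
  proof cases
    case 2
    then obtain ps qs where "a # xs @ [y] = ps @ i # j # qs" using Cons.IH by blast
    then have "x # (a # xs) @ [y] = (x # ps) @ i # j # qs" by simp
    then show ?thesis by blast
  qed (auto intro: exI[of _ "[]"])
qed (auto intro: exI[of _ "[]"])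

text \<open>The pointwise form of \<open>x = B \<otimes> x \<oplus> b\<close> over max-plus.\<close>

definition affine_solution :: "real^'n^'n \<Rightarrow> ('n \<Rightarrow> real) \<Rightarrow> ('n \<Rightarrow> real) \<Rightarrow> bool" where
  "affine_solution B b x \<longleftrightarrow>
     (\<forall>i. b i \<le> x i \<and> (\<forall>j. B $ i $ j + x j \<le> x i) \<and> (x i = b i \<or> (\<exists>j. x i = B $ i $ j + x j)))"

lemma affine_solution_imp_cycle_weight_nonpos:
  assumes "affine_solution B b x"
  shows "walk_weight B (u # us @ [u]) \<le> 0"
proof -
  have edge: "B $ i $ j + x j \<le> x i" for i j
    using assms by (simp add: affine_solution_def)
  show ?thesis
    using walk_weight_le_of_edges_le[of B x "u # us @ [u]", OF edge] by simp
qed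

section \<open>The Kleene star as a supremum of walk weights\<close>

locale nonpos_cycles =
  fixes B :: "real^'n^'n"
  assumes cycle_weight_nonpos: "walk_weight B (x # xs @ [x]) \<le> 0"
begin

text \<open>Real-valued, since the digraph is complete (some walk exists) and
  \<open>walk_weight_le_uminus\<close> bounds all weights. The edgeless walk accounts for the
  identity summand of the Kleene star.\<close>

definition star :: "'n \<Rightarrow> 'n \<Rightarrow> real" where
  "star i j = (SUP p\<in>walks i j. walk_weight B p)"

text \<open>Appending the edge from \<open>j\<close> back to \<open>i\<close> closes the walk, and
  closed walks have nonpositive weight.\<close>

lemma walk_weight_le_uminus:
  assumes "p \<in> walks i j"
  shows "walk_weight B p \<le> - B $ j $ i"
proof -
  from assms have p: "p \<noteq> []" "hd p = i" "last p = j" by (auto simp: walks_def)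
  have "walk_weight B (butlast p @ j # [i]) = walk_weight B p + B $ j $ i"
    using p by (subst walk_weight_append) (simp flip: p(3))
  moreover have "butlast p @ j # [i] = i # tl p @ [i]"
    using p by (metis append.assoc append_Cons append_Nil append_butlast_last_id list.collapse)
  ultimately show ?thesis using cycle_weight_nonpos[of i "tl p"] by simp
qed

lemma walks_nonempty: "walks i j \<noteq> {}"
proof -
  have "[i, j] \<in> walks i j" by (simp add: walks_def)
  then show ?thesis by blast
qed

lemma walk_weight_le_star: "p \<in> walks i j \<Longrightarrow> walk_weight B p \<le> star i j"
  unfolding star_def
  by (intro cSUP_upper bdd_aboveI2[where M = "- B $ j $ i"] walk_weight_le_uminus)

lemma star_least:
  assumes "\<And>p. p \<in> walks i j \<Longrightarrow> walk_weight B p \<le> c"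
  shows "star i j \<le> c"
  unfolding star_def using walks_nonempty assms by (rule cSUP_least)

lemma star_le_uminus: "star i j \<le> - B $ j $ i"
  by (intro star_least walk_weight_le_uminus)

lemma edge_le_star: "B $ i $ j \<le> star i j"
  using walk_weight_le_star[of "[i, j]" i j] by (simp add: walks_def)

lemma star_diag [simp]: "star i i = 0"
proof (rule antisym)
  show "star i i \<le> 0"
  proof (rule star_least)
    fix p assume "p \<in> walks i i"
    then have p: "p \<noteq> []" "hd p = i" "last p = i" by (auto simp: walks_def)
    then obtain q where q: "p = i # q" by (metis list.collapse)
    show "walk_weight B p \<le> 0"
    proof (cases "q = []")
      case False
      then have "p = i # butlast q @ [i]" using p(3) q by auto
      then show ?thesis using cycle_weight_nonpos by metis
    qed (simp add: q)
  qed
  show "0 \<le> star i i"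
    using walk_weight_le_star[of "[i]" i i] by (simp add: walks_def)
qed

lemma star_trans: "star i j + star j k \<le> star i k"
proof -
  have "walk_weight B p + walk_weight B q \<le> star i k" if p: "p \<in> walks i j" and q: "q \<in> walks j k" for p q
  proof -
    from p have p': "p = butlast p @ [j]" by (auto simp: walks_def)
    from q have q': "q = j # tl q" by (auto simp: walks_def)
    have "butlast p @ j # tl q = p @ tl q" using p' by (metis append.assoc append_Cons append_Nil)
    moreover have "p @ tl q \<in> walks i k" using p q by (cases q) (auto simp: walks_def)
    ultimately have "walk_weight B (butlast p @ j # tl q) \<le> star i k"
      using walk_weight_le_star by metis
    then show ?thesis
      by (subst (asm) walk_weight_append) (simp flip: p' q')
  qed
  \<comment> \<open>The supremum over \<open>q\<close> is taken first with \<open>p\<close> fixed,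
    then the one over \<open>p\<close>.\<close>
  then have "star j k \<le> star i k - walk_weight B p" if "p \<in> walks i j" for p
    using that by (intro star_least) (fastforce simp: algebra_simps)
  then have "star i j \<le> star i k - star j k"
    by (intro star_least) (fastforce simp: algebra_simps)
  then show ?thesis by simp
qed

lemma edge_star_le: "B $ i $ k + star k j \<le> star i j"
  using edge_le_star[of i k] star_trans[of i k j] by simp

lemma star_edge_le: "star i k + B $ k $ j \<le> star i j"
  using edge_le_star[of k j] star_trans[of i k j] by simp

text \<open>A walk between distinct nodes has a first edge. Among the finitely many choices of its
  head, a best one attains the supremum.\<close>

lemma star_unfold:
  assumes "i \<noteq> j"
  obtains k where "star i j = B $ i $ k + star k j"
proof -
  define c where "c = (MAX k. B $ i $ k + star k j)"
  have "star i j \<le> c"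
  proof (rule star_least)
    fix p assume "p \<in> walks i j"
    then obtain k q where "p = i # k # q" "last (k # q) = j"
      using assms by (cases p rule: remdups_adj.cases) (auto simp: walks_def)
    moreover from this have "walk_weight B (k # q) \<le> star k j"
      by (intro walk_weight_le_star) (simp add: walks_def)
    moreover have "B $ i $ k + star k j \<le> c" unfolding c_def by (rule Max_ge) auto
    ultimately show "walk_weight B p \<le> c" by simp
  qed
  moreover have "c \<in> range (\<lambda>k. B $ i $ k + star k j)" unfolding c_def by (rule Max_in) auto
  then obtain k where "c = B $ i $ k + star k j" by blast
  ultimately have "star i j = B $ i $ k + star k j" using edge_star_le[of i k j] by simp
  then show ?thesis by (rule that)
qed

lemma star_le_of_edges_le:
  assumes "\<And>i j. B $ i $ j + x j \<le> x i"
  shows "star i j + x j \<le> x i"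
proof -
  have "star i j \<le> x i - x j"
    using walk_weight_le_of_edges_le[of B x, OF assms]
    by (intro star_least) (fastforce simp: walks_def)
  then show ?thesis by simp
qed

text \<open>Removing the edge from a zero-weight cycle leaves a walk from \<open>j\<close> through
  \<open>x\<close> to \<open>i\<close>, whose weight makes the bound \<open>star_le_uminus\<close>
  sharp.\<close>

lemma zero_cycle_edge:
  assumes "walk_weight B (x # xs @ [x]) = 0" "(i, j) \<in> set (cycle_edges (x # xs))"
  shows "B $ i $ j + star j i = 0"
proof -
  from assms(2) obtain ps qs where split: "x # xs @ [x] = ps @ i # j # qs"
    using in_zip_shift_split[of i j x xs x] by (auto simp: cycle_edges_def)
  have "walk_weight B (ps @ [i]) \<le> star x i"
    using arg_cong[OF split, of hd] by (intro walk_weight_le_star) (cases ps; simp add: walks_def)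
  moreover have "walk_weight B (j # qs) \<le> star j x"
    using arg_cong[OF split, of last] by (intro walk_weight_le_star) (auto simp: walks_def)
  moreover have "walk_weight B (ps @ [i]) + (B $ i $ j + walk_weight B (j # qs)) = 0"
    using assms(1) unfolding split by (subst (asm) walk_weight_append) simp
  ultimately show ?thesis
    using star_trans[of j x i] star_le_uminus[of j i] by simp
qed

section \<open>Solutions of the affine equation in terms of the star\<close>

lemma affine_solution_if_star_span:
  assumes closed: "\<And>i j. star i j + x j \<le> x i"
    and above: "\<And>i. b i \<le> x i"
    and span: "\<And>i. \<exists>j. x i = star i j + b j \<or> (j \<in> N \<and> x i = star i j + x j)"
    and N: "\<And>m. m \<in> N \<Longrightarrow> \<exists>k. B $ m $ k + star k m = 0"
  shows "affine_solution B b x"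
  unfolding affine_solution_def
proof (intro allI conjI)
  fix i
  show "b i \<le> x i" by (rule above)
  show "B $ i $ j + x j \<le> x i" for j
    using edge_le_star[of i j] closed[of i j] by simp
  have upper: "B $ i $ k + x k \<le> x i" for k
    using edge_le_star[of i k] closed[of i k] by simp
  obtain j where "x i = star i j + b j \<or> (j \<in> N \<and> x i = star i j + x j)"
    using span by blast
  then show "x i = b i \<or> (\<exists>j. x i = B $ i $ j + x j)"
  proof (elim disjE conjE)
    assume j: "x i = star i j + b j"
    show ?thesis
    proof (cases "i = j")
      case False
      then obtain k where "star i j = B $ i $ k + star k j" by (rule star_unfold)
      \<comment> \<open>Replacing \<open>star k j + b j\<close> by the larger \<open>x k\<close>
        keeps equality, because \<open>upper\<close> bounds the result by \<open>x i\<close>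
        again.\<close>
      then have "x i = B $ i $ k + x k"
        using j closed[of k j] above[of j] upper[of k] by linarith
      then show ?thesis by blast
    qed (use j in simp)
  next
    assume j: "j \<in> N" "x i = star i j + x j"
    \<comment> \<open>For \<open>i = j\<close> the optimal walk has no first edge; \<open>N\<close>
      then supplies an edge that the star closes to weight 0, the value of
      \<open>star i i\<close>.\<close>
    obtain k where "star i j = B $ i $ k + star k j"
    proof (cases "i = j")
      case True
      then show ?thesis using N[OF j(1)] that by force
    qed (metis star_unfold that)
    then have "x i = B $ i $ k + x k"
      using j closed[of k j] upper[of k] by linarith
    then show ?thesis by blast
  qed
qed

text \<open>The tight equalities telescope along the orbit of \<open>f\<close>. \<open>Suc n\<close>
  steps ensure at least one edge, so a return to the start is a genuine cycle.\<close>

lemma orbit_walk_weight: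
  assumes step: "\<And>i. i \<in> D \<Longrightarrow> f i \<in> D \<and> x i = B $ i $ f i + x (f i)"
    and "i \<in> D"
  shows "\<exists>us. walk_weight B (i # us @ [(f ^^ Suc n) i]) = x i - x ((f ^^ Suc n) i)"
  using \<open>i \<in> D\<close>
proof (induction n arbitrary: i)
  case 0
  then show ?case using step[of i] by (intro exI[of _ "[]"]) simp
next
  case (Suc n)
  obtain us where "walk_weight B (f i # us @ [(f ^^ Suc n) (f i)]) = x (f i) - x ((f ^^ Suc n) (f i))"
    using Suc.IH step[OF Suc.prems] by blast
  then show ?case
    using step[OF Suc.prems] by (intro exI[of _ "f i # us"]) (simp add: funpow_swap1)
qed

text \<open>
  Outside the span, some edge into another node outside the span attains the maximum, so that
  following these edges closes a zero-weight cycle, whose nodes lie in the span by \<open>N\<close>.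
\<close>

lemma affine_solution_star_span:
  assumes sol: "affine_solution B b x"
    and N: "\<And>u us. walk_weight B (u # us @ [u]) = 0 \<Longrightarrow> \<exists>m\<in>N. star u m + star m u = 0"
  shows "\<exists>j. x i = star i j + b j \<or> (j \<in> N \<and> x i = star i j + x j)"
proof (rule ccontr)
  define span where "span = {i. \<exists>j. x i = star i j + b j \<or> (j \<in> N \<and> x i = star i j + x j)}"
  assume "\<not> ?thesis"
  then have i: "i \<in> - span" by (simp add: span_def)
  have edge: "B $ i $ j + x j \<le> x i" for i j
    using sol by (simp add: affine_solution_def)
  have closed: "star i j + x j \<le> x i" for i j
    using edge by (rule star_le_of_edges_le)
  have above: "b i \<le> x i" for i
    using sol by (simp add: affine_solution_def)
  have "\<exists>k. k \<in> - span \<and> x v = B $ v $ k + x k" if v: "v \<in> - span" for v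
  proof -
    have "x v \<noteq> b v"
    proof
      assume "x v = b v"
      then have "x v = star v v + b v" by simp
      then show False using v unfolding span_def by blast
    qed
    then obtain k where k: "x v = B $ v $ k + x k"
      using sol unfolding affine_solution_def by blast
    have "k \<notin> span"
    proof
      assume "k \<in> span"
      then obtain j where "x k = star k j + b j \<or> (j \<in> N \<and> x k = star k j + x j)"
        unfolding span_def by blast
      \<comment> \<open>Prepending the tight edge to a representation of \<open>x k\<close> gives
        one of \<open>x v\<close>; \<open>closed\<close> and \<open>above\<close> show that the star
        cannot exceed it.\<close>
      then have "x v = star v j + b j \<or> (j \<in> N \<and> x v = star v j + x j)"
        using k edge_star_le[of v k j] closed[of v j] above[of j] by auto
      then show False using v unfolding span_def by blast
    qed
    then show ?thesis using k by blast
  qed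
  then obtain f where f: "\<And>v. v \<in> - span \<Longrightarrow> f v \<in> - span \<and> x v = B $ v $ f v + x (f v)"
    by metis
  have orbit: "(f ^^ n) i \<in> - span" for n
    by (induction n) (use i f in auto)
  \<comment> \<open>Pigeonhole: the orbit stays in a finite type and must repeat.\<close>
  have "\<not> inj (\<lambda>n. (f ^^ n) i)"
    using finite_imageD[of "\<lambda>n. (f ^^ n) i" UNIV] finite_subset[OF subset_UNIV finite_class.finite_UNIV]
    by auto
  then obtain s t where st: "s < t" "(f ^^ s) i = (f ^^ t) i"
    unfolding inj_def by (metis nat_neq_iff)
  define c where "c = (f ^^ s) i"
  \<comment> \<open>The positive period \<open>t - s\<close> is written as a successor to fit
    \<open>orbit_walk_weight\<close>.\<close>
  have "(f ^^ Suc (t - Suc s)) c = (f ^^ (t - s + s)) i"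
    unfolding c_def using st by (simp only: funpow_add o_apply Suc_diff_Suc)
  then have "(f ^^ Suc (t - Suc s)) c = c"
    using st by (simp add: c_def)
  then obtain us where "walk_weight B (c # us @ [c]) = 0"
    using orbit_walk_weight[OF f, of c "t - Suc s"] orbit[of s] unfolding c_def[symmetric] by auto
  then obtain m where m: "m \<in> N" "star c m + star m c = 0"
    using N by blast
  \<comment> \<open>Going from \<open>c\<close> to \<open>m\<close> and back costs 0, so the two
    inequalities from \<open>closed\<close> are equalities.\<close>
  then have "x c = star c m + x m"
    using closed[of c m] closed[of m c] by linarith
  then show False
    using m(1) orbit[of s] unfolding c_def[symmetric] span_def by blast
qed

text \<open>The first hypothesis keeps \<open>N\<close> inside the nodes on tight cycles and serves
  the backward direction; the second makes \<open>N\<close> meet every zero-weight cycle up to star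
  equivalence and serves the forward one.\<close>

lemma affine_solution_iff:
  assumes "\<And>m. m \<in> N \<Longrightarrow> \<exists>k. B $ m $ k + star k m = 0"
    and "\<And>u us. walk_weight B (u # us @ [u]) = 0 \<Longrightarrow> \<exists>m\<in>N. star u m + star m u = 0"
  shows "affine_solution B b x \<longleftrightarrow>
    (\<forall>i j. star i j + x j \<le> x i) \<and> (\<forall>i. b i \<le> x i) \<and>
    (\<forall>i. \<exists>j. x i = star i j + b j \<or> (j \<in> N \<and> x i = star i j + x j))"
    (is "_ \<longleftrightarrow> ?span")
proof
  assume sol: "affine_solution B b x"
  then have "star i j + x j \<le> x i" for i j
    by (intro star_le_of_edges_le) (simp add: affine_solution_def)
  then show ?span
    using sol affine_solution_star_span[OF sol assms(2)] by (auto simp: affine_solution_def)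
next
  assume ?span
  then show "affine_solution B b x"
    using assms(1) by (intro affine_solution_if_star_span) blast+
qed

text \<open>The max-plus analogue of the Neumann series: the star applied to \<open>b\<close> is
  spanned by \<open>b\<close> alone, the case of empty \<open>N\<close>.\<close>

lemma affine_solution_star_Max:
  "affine_solution B b (\<lambda>i. MAX j. star i j + b j)"
proof (rule affine_solution_if_star_span[where N = "{}"])
  fix i j
  define x where "x = (\<lambda>i. MAX j. star i j + b j)"
  have le: "star i j + b j \<le> x i" for i j
    unfolding x_def by (rule Max_ge) auto
  have attained: "\<exists>j. x i = star i j + b j" for i
  proof -
    have "x i \<in> range (\<lambda>j. star i j + b j)" unfolding x_def by (rule Max_in) auto
    then show ?thesis by blast
  qed
  obtain k where "x j = star j k + b k" using attained by blast
  then have "star i j + x j \<le> x i"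
    using star_trans[of i j k] le[of i k] by simp
  then show "star i j + (MAX k. star j k + b k) \<le> (MAX k. star i k + b k)"
    by (simp add: x_def)
  show "b i \<le> (MAX j. star i j + b j)"
    using le[of i i] by (simp add: x_def)
  show "\<exists>j. (MAX j. star i j + b j) = star i j + b j \<or>
      j \<in> {} \<and> (MAX j. star i j + b j) = star i j + (MAX k. star j k + b k)"
    using attained[of i] by (auto simp: x_def)
qed simp

section \<open>Agreement with the tropical powers\<close>

lemma mp_pow_le_star:
  "mp_pow (\<chi> i j. ereal (B $ i $ j)) k $ i $ j \<le> ereal (star i j)"
proof (induction k arbitrary: j)
  case (Suc k)
  have "mp_pow (\<chi> i j. ereal (B $ i $ j)) k $ i $ m + ereal (B $ m $ j) \<le> ereal (star i j)" for m
  proof -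
    have "mp_pow (\<chi> i j. ereal (B $ i $ j)) k $ i $ m + ereal (B $ m $ j)
        \<le> ereal (star i m) + ereal (B $ m $ j)"
      using Suc.IH by (rule add_right_mono)
    also have "\<dots> \<le> ereal (star i j)" using star_edge_le by simp
    finally show ?thesis .
  qed
  then show ?case by (simp add: mp_mult_def)
qed (simp add: mp_one_def)

text \<open>The k-th power optimises over walks with k edges. Powers multiply on the right, so the
  induction appends nodes at the end.\<close>

lemma walk_weight_le_mp_pow:
  assumes "p \<noteq> []"
  shows "ereal (walk_weight B p) \<le> mp_pow (\<chi> i j. ereal (B $ i $ j)) (length p - 1) $ hd p $ last p"
  using assms
proof (induction p rule: rev_nonempty_induct)
  case (snoc m p)
  let ?P = "mp_pow (\<chi> i j. ereal (B $ i $ j))"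
  have "walk_weight B (butlast p @ last p # [m]) = walk_weight B p + B $ last p $ m"
    using snoc.hyps by (subst walk_weight_append) simp
  moreover have "butlast p @ last p # [m] = p @ [m]"
    using snoc.hyps by (metis append.assoc append_Cons append_Nil append_butlast_last_id)
  ultimately have "ereal (walk_weight B (p @ [m])) = ereal (walk_weight B p) + ereal (B $ last p $ m)"
    by simp
  also have "\<dots> \<le> ?P (length p - 1) $ hd p $ last p + ereal (B $ last p $ m)"
    using snoc.IH by (rule add_right_mono)
  also have "\<dots> \<le> (MAX j. ?P (length p - 1) $ hd p $ j + ereal (B $ j $ m))"
    by (rule Max_ge) auto
  also have "\<dots> = ?P (Suc (length p - 1)) $ hd p $ m"
    by (simp add: mp_mult_def)
  finally show ?case using snoc.hyps by simp
qed (simp add: mp_one_def)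

lemma mp_star_eq: "mp_star (\<chi> i j. ereal (B $ i $ j)) $ i $ j = ereal (star i j)"
proof (rule antisym)
  let ?S = "mp_star (\<chi> i j. ereal (B $ i $ j)) $ i $ j"
  show le: "?S \<le> ereal (star i j)"
    unfolding mp_star_def by (simp add: SUP_least mp_pow_le_star)
  have ge: "ereal (walk_weight B p) \<le> ?S" if p: "p \<in> walks i j" for p
  proof -
    have "ereal (walk_weight B p) \<le> mp_pow (\<chi> i j. ereal (B $ i $ j)) (length p - 1) $ i $ j"
      using walk_weight_le_mp_pow[of p] p by (simp add: walks_def)
    also have "\<dots> \<le> ?S"
      unfolding mp_star_def vec_lambda_beta by (rule SUP_upper) simp
    finally show ?thesis .
  qed
  \<comment> \<open>\<open>star_least\<close> lives in the reals, hence the split on the extended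
    value; minus infinity is impossible since some walk has finite weight below it.\<close>
  show "ereal (star i j) \<le> ?S"
  proof (cases ?S)
    case (real r)
    then show ?thesis using ge by (auto intro: star_least)
  next
    case MInf
    then show ?thesis using ge walks_nonempty[of i j] by fastforce
  qed (use le in simp)
qed

end

section \<open>The critical graph\<close>

lemma wf_digraph_critical_graph: "wf_digraph (with_proj (critical_graph A))"
proof
  fix e assume "e \<in> arcs (with_proj (critical_graph A))"
  then obtain c where c: "critical_cycle A c" "(fst e, snd e) \<in> set (zip c (rotate1 c))"
    by (auto simp: critical_graph_def cycle_edges_def)
  then have "fst e \<in> set c" "snd e \<in> set c"
    using set_zip_leftD[OF c(2)] set_zip_rightD[OF c(2)] by simp_all
  then show "tail (with_proj (critical_graph A)) e \<in> verts (with_proj (critical_graph A))"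
    "head (with_proj (critical_graph A)) e \<in> verts (with_proj (critical_graph A))"
    using c(1) by (auto simp: critical_graph_def)
qed

lemma critical_node_has_edge:
  assumes "i \<in> pverts (critical_graph A)"
  shows "\<exists>j. (i, j) \<in> parcs (critical_graph A)"
proof -
  obtain c where c: "critical_cycle A c" "i \<in> set c"
    using assms by (auto simp: critical_graph_def)
  then obtain k where "k < length c" "i = c ! k"
    by (auto simp: in_set_conv_nth)
  then have "(i, rotate1 c ! k) \<in> set (cycle_edges c)"
    unfolding cycle_edges_def set_zip by auto
  then show ?thesis using c(1) by (auto simp: critical_graph_def)
qed

locale bounded_cycle_mean =
  fixes A :: "real^'n^'n" and l :: real
  assumes max_cycle_mean_le: "max_cycle_mean A \<le> l"
begin

sublocale nonpos_cycles "\<chi> i j. A $ i $ j - l"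
  using max_cycle_mean_le unfolding max_cycle_mean_le_iff by unfold_locales blast

text \<open>Such a cycle has mean \<open>l\<close>, so \<open>l\<close> is at most the maximum cycle
  mean and therefore equal to it. For any other \<open>l\<close> there is no such cycle, in
  accordance with the empty \<open>N\<close>.\<close>

lemma zero_cycle_critical:
  assumes "walk_weight (\<chi> i j. A $ i $ j - l) (u # us @ [u]) = 0"
  shows "l = max_cycle_mean A" "critical_cycle A (u # us)"
proof -
  have eq: "cycle_mean A (u # us) = l"
    using assms by (simp add: cycle_mean_eq_iff)
  have "cycle_mean A (u # us) \<le> max_cycle_mean A"
    unfolding max_cycle_mean_def by (rule cSUP_upper[OF _ bdd_above_cycle_mean]) simp
  then show "l = max_cycle_mean A" using eq max_cycle_mean_le by simp
  then show "critical_cycle A (u # us)" using eq by (simp add: critical_cycle_def)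
qed

lemma critical_edge_star:
  assumes "l = max_cycle_mean A" "(i, j) \<in> parcs (critical_graph A)"
  shows "A $ i $ j - l + star j i = 0"
proof -
  obtain c where c: "critical_cycle A c" "(i, j) \<in> set (cycle_edges c)"
    using assms(2) by (auto simp: critical_graph_def)
  then obtain x xs where "c = x # xs"
    by (cases c) (auto simp: critical_cycle_def)
  then show ?thesis
    using zero_cycle_edge[of x xs i j] c assms(1)
    by (simp add: critical_cycle_def flip: cycle_mean_eq_iff)
qed

text \<open>Each critical edge can be undone by the star at total cost 0, and this adds up along a
  path. The conclusion says that columns \<open>i\<close> and \<open>j\<close> of the star differ by
  a constant.\<close>

lemma critical_reachable_star:
  assumes "l = max_cycle_mean A" "i \<rightarrow>\<^sup>*\<^bsub>with_proj (critical_graph A)\<^esub> j"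
  shows "star i j + star j i = 0"
proof -
  interpret wf_digraph "with_proj (critical_graph A)" by (rule wf_digraph_critical_graph)
  show ?thesis
    using assms(2)
  proof (induction rule: reachable_induct)
    case (step j k)
    then have "A $ j $ k - l + star k j = 0"
      using critical_edge_star[OF assms(1)] by simp
    then show ?case
      using step.IH star_edge_le[of i j k] star_trans[of k j i] star_trans[of i k i] by simp
  qed simp
qed

lemma is_NC_star_edge:
  assumes "is_NC A l N" "m \<in> N"
  shows "\<exists>k. (\<chi> i j. A $ i $ j - l) $ m $ k + star k m = 0"
proof -
  have l: "l = max_cycle_mean A"
    using assms by (auto simp: is_NC_def split: if_splits)
  then have "m \<in> pverts (critical_graph A)"
    using assms by (auto simp: is_NC_def)
  then show ?thesis
    using critical_node_has_edge critical_edge_star[OF l] by fastforce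
qed

text \<open>The cycle is critical, so the component of \<open>u\<close> contains a representative,
  reachable from \<open>u\<close> in the critical graph.\<close>

lemma is_NC_star_cycle:
  assumes N: "is_NC A l N" and cyc: "walk_weight (\<chi> i j. A $ i $ j - l) (u # us @ [u]) = 0"
  shows "\<exists>m\<in>N. star u m + star m u = 0"
proof -
  interpret G: wf_digraph "with_proj (critical_graph A)" by (rule wf_digraph_critical_graph)
  note l = zero_cycle_critical(1)[OF cyc]
  have "u \<in> verts (with_proj (critical_graph A))"
    using zero_cycle_critical(2)[OF cyc] by (auto simp: critical_graph_def)
  then have "G.scc_of u \<in> G.sccs_verts"
    by (rule G.scc_of_in_sccs_verts)
  then obtain m where "m \<in> N" "m \<in> G.scc_of u"
    using N l unfolding is_NC_def by (metis (no_types, lifting) Int_iff)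
  then show ?thesis
    using critical_reachable_star[OF l] by (auto simp: G.scc_of_def)
qed

lemma mp_star_shift_mat: "mp_star (shift_mat A l) $ i $ j = ereal (star i j)"
  using mp_star_eq[of i j] by (simp add: shift_mat_def)

text \<open>Residuation: the finite star entries move across the inequality, turning the min-plus
  bound on \<open>z\<close> into a max-plus bound by 1.\<close>

lemma le_minplus_sharp_star_iff:
  assumes "\<And>i. z $ i \<noteq> \<infinity>"
  shows "z \<le> minplus_mat_vec (mp_sharp (mp_star (shift_mat A l))) 1 \<longleftrightarrow>
    (\<forall>i j. ereal (star i j) + z $ j \<le> 1)"
proof -
  have "z $ j \<le> - ereal (star i j) + 1 \<longleftrightarrow> ereal (star i j) + z $ j \<le> 1" for i j
    using assms[of j] by (cases "z $ j") (auto simp: one_ereal_def)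
  then show ?thesis
    by (auto simp: less_eq_vec_def minplus_mat_vec_def mp_sharp_def mp_star_shift_mat)
qed

end

section \<open>Pure eigenvectors as max-plus affine solutions\<close>

lemma eq_Max_range_iff:
  fixes f :: "'a::finite \<Rightarrow> 'b::linorder"
  shows "y = Max (range f) \<longleftrightarrow> (\<forall>j. f j \<le> y) \<and> (\<exists>j. y = f j)"
  by (subst eq_commute, subst Max_eq_iff) auto

text \<open>For \<open>1 - l \<le> x $ i\<close> the left product is not truncated. A truncated
  maximum on the right means that both sides are 0, that is \<open>x $ i = 1 - l\<close>; this is
  the constant term of the affine equation.\<close>

lemma pure_luk_eigenvector_iff:
  assumes "l \<le> 1"
  shows "pure_luk_eigenvector A l x \<longleftrightarrow>
    (\<forall>i. x $ i \<le> 1) \<and> affine_solution (\<chi> i j. A $ i $ j - l) (\<lambda>_. 1 - l) (($) x)"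
proof -
  have "luk_mult l (x $ i) = (MAX j. luk_mult (A $ i $ j) (x $ j)) \<longleftrightarrow>
      (\<forall>j. A $ i $ j - l + x $ j \<le> x $ i) \<and>
      (x $ i = 1 - l \<or> (\<exists>j. x $ i = A $ i $ j - l + x $ j))"
    if "1 - l \<le> x $ i" for i
  proof -
    have le: "luk_mult (A $ i $ j) (x $ j) \<le> luk_mult l (x $ i) \<longleftrightarrow> A $ i $ j - l + x $ j \<le> x $ i" for j
      using that by (auto simp: luk_mult_def)
    \<comment> \<open>The second alternative is the truncated case, where both products
      vanish.\<close>
    have eq: "luk_mult l (x $ i) = luk_mult (A $ i $ j) (x $ j) \<longleftrightarrow>
        x $ i = A $ i $ j - l + x $ j \<or> (x $ i = 1 - l \<and> A $ i $ j - l + x $ j \<le> x $ i)" for j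
      using that by (auto simp: luk_mult_def max_def)
    show ?thesis
      unfolding eq_Max_range_iff le eq by blast
  qed
  then have eq: "luk_mat_vec A x = luk_scal_vec l x \<longleftrightarrow>
      (\<forall>i. (\<forall>j. A $ i $ j - l + x $ j \<le> x $ i) \<and>
        (x $ i = 1 - l \<or> (\<exists>j. x $ i = A $ i $ j - l + x $ j)))"
    if "\<forall>i. 1 - l \<le> x $ i"
    using that by (simp add: vec_eq_iff luk_mat_vec_def luk_scal_vec_def eq_commute[of "Max _"])
  have "0 \<le> x $ i" if "1 - l \<le> x $ i" for i
    using assms that by simp
  then show ?thesis
    unfolding pure_luk_eigenvector_def affine_solution_def using eq by fastforce
qed

context bounded_cycle_mean
begin

lemma mp_star_affine_iff:
  assumes "\<forall>i. i \<notin> N \<longrightarrow> z $ i = -\<infinity>"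
  shows "ereal_vec x = mp_mat_vec (mp_star (shift_mat A l)) (mp_add_vec (mp_scal_vec (ereal b) 0) z) \<longleftrightarrow>
    (\<forall>i. (\<forall>j. star i j + b \<le> x $ i) \<and> (\<forall>j. ereal (star i j) + z $ j \<le> ereal (x $ i)) \<and>
      (\<exists>j. x $ i = star i j + b \<or> (j \<in> N \<and> ereal (x $ i) = ereal (star i j) + z $ j)))"
proof -
  have max: "ereal (star i j) + max (ereal b) (z $ j) = max (ereal (star i j + b)) (ereal (star i j) + z $ j)"
    for i j by (cases "z $ j") (auto simp: max_def)
  \<comment> \<open>A real value cannot be attained through \<open>z $ j = -\<infinity>\<close>, so
    attainment by \<open>z\<close> forces \<open>j \<in> N\<close>.\<close>
  have attained: "ereal y = max (ereal (star i j + b)) (ereal (star i j) + z $ j) \<longleftrightarrow>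
      y = star i j + b \<or> (j \<in> N \<and> ereal y = ereal (star i j) + z $ j)"
    if "star i j + b \<le> y" "ereal (star i j) + z $ j \<le> ereal y" for y i j
    using that assms by (cases "z $ j"; cases "j \<in> N") (auto simp: max_def)
  have "ereal_vec x = mp_mat_vec (mp_star (shift_mat A l)) (mp_add_vec (mp_scal_vec (ereal b) 0) z) \<longleftrightarrow>
    (\<forall>i. ereal (x $ i) = (MAX j. max (ereal (star i j + b)) (ereal (star i j) + z $ j)))"
    by (simp add: vec_eq_iff ereal_vec_def mp_mat_vec_def mp_add_vec_def mp_scal_vec_def
        mp_star_shift_mat max)
  also have "\<dots> \<longleftrightarrow> (\<forall>i. ((\<forall>j. star i j + b \<le> x $ i) \<and> (\<forall>j. ereal (star i j) + z $ j \<le> ereal (x $ i))) \<and>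
      (\<exists>j. ereal (x $ i) = max (ereal (star i j + b)) (ereal (star i j) + z $ j)))"
    unfolding eq_Max_range_iff by auto
  also have "\<dots> \<longleftrightarrow> (\<forall>i. ((\<forall>j. star i j + b \<le> x $ i) \<and> (\<forall>j. ereal (star i j) + z $ j \<le> ereal (x $ i))) \<and>
      (\<exists>j. x $ i = star i j + b \<or> (j \<in> N \<and> ereal (x $ i) = ereal (star i j) + z $ j)))"
    by (simp add: attained cong: conj_cong)
  finally show ?thesis by (simp only: conj_assoc)
qed

text \<open>Nonnegative entries let any walk be closed up at the cost \<open>l\<close> of one edge.\<close>

lemma star_le:
  assumes "\<And>i j. 0 \<le> A $ i $ j"
  shows "star i j \<le> l"
  using star_le_uminus[of i j] assms[of j i] by simp

text \<open>The witness is the star applied to the constant \<open>1 - l\<close>;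
  \<open>star_le\<close> keeps it at most 1.\<close>

lemma pure_luk_eigenvector_exists:
  assumes "\<And>i j. 0 \<le> A $ i $ j" "l \<le> 1"
  shows "\<exists>x. pure_luk_eigenvector A l x"
proof -
  have "star i j + (1 - l) \<le> 1" for i j
    using star_le[OF assms(1), of i j] by simp
  then have "pure_luk_eigenvector A l (\<chi> i. MAX j. star i j + (1 - l))"
    using affine_solution_star_Max[of "\<lambda>_. 1 - l"]
    by (simp add: pure_luk_eigenvector_iff[OF assms(2)] vec_lambda_inverse)
  then show ?thesis by blast
qed

lemma mp_star_zero_le:
  assumes "\<And>i j. 0 \<le> A $ i $ j"
  shows "(MAX i. mp_mat_vec (mp_star (shift_mat A l)) 0 $ i) \<le> ereal l"
  using star_le[OF assms] by (simp add: mp_mat_vec_def mp_star_shift_mat)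

lemma pure_luk_eigenvector_star_iff:
  assumes nonneg: "\<And>i j. 0 \<le> A $ i $ j" and "l \<le> 1" and N: "is_NC A l N"
  shows "pure_luk_eigenvector A l x \<longleftrightarrow>
    (\<exists>z. (\<forall>i. z $ i \<noteq> \<infinity>) \<and>
      z \<le> minplus_mat_vec (mp_sharp (mp_star (shift_mat A l))) 1 \<and>
      (\<forall>i. i \<notin> N \<longrightarrow> z $ i = -\<infinity>) \<and>
      ereal_vec x = mp_mat_vec (mp_star (shift_mat A l))
        (mp_add_vec (mp_scal_vec (ereal (1 - l)) 0) z))"
    (is "_ \<longleftrightarrow> ?rep")
proof -
  have solution_iff: "affine_solution (\<chi> i j. A $ i $ j - l) (\<lambda>_. 1 - l) (($) x) \<longleftrightarrow>
      (\<forall>i j. star i j + x $ j \<le> x $ i) \<and> (\<forall>i. 1 - l \<le> x $ i) \<and>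
      (\<forall>i. \<exists>j. x $ i = star i j + (1 - l) \<or> (j \<in> N \<and> x $ i = star i j + x $ j))"
    by (rule affine_solution_iff[OF is_NC_star_edge[OF N] is_NC_star_cycle[OF N]])
  show ?thesis
  proof
    assume "pure_luk_eigenvector A l x"
    then have le1: "x $ i \<le> 1"
      and closed: "star i j + x $ j \<le> x $ i"
      and above: "1 - l \<le> x $ i"
      and span: "\<exists>j. x $ i = star i j + (1 - l) \<or> (j \<in> N \<and> x $ i = star i j + x $ j)" for i j
      unfolding pure_luk_eigenvector_iff[OF \<open>l \<le> 1\<close>] solution_iff by blast+
    \<comment> \<open>The coefficients are the values of \<open>x\<close> itself at the
      representatives.\<close>
    define z where "z = (\<chi> i. if i \<in> N then ereal (x $ i) else -\<infinity>)"
    have z: "z $ i \<noteq> \<infinity>" "i \<notin> N \<Longrightarrow> z $ i = -\<infinity>" for i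
      by (simp_all add: z_def)
    have "star i j + (1 - l) \<le> x $ i" for i j
      using closed[of i j] above[of j] by simp
    moreover have z_le: "ereal (star i j) + z $ j \<le> ereal (x $ i)" for i j
      using closed[of i j] by (simp add: z_def)
    moreover have "\<exists>j. x $ i = star i j + (1 - l) \<or> (j \<in> N \<and> ereal (x $ i) = ereal (star i j) + z $ j)" for i
      using span[of i] by (auto simp: z_def)
    ultimately have "ereal_vec x = mp_mat_vec (mp_star (shift_mat A l))
        (mp_add_vec (mp_scal_vec (ereal (1 - l)) 0) z)"
      using mp_star_affine_iff[where N = N and z = z and x = x and b = "1 - l"] z(2) by blast
    moreover have "ereal (star i j) + z $ j \<le> 1" for i j
      by (rule order_trans[OF z_le[of i j]]) (simp add: le1)
    ultimately show ?rep
      using z le_minplus_sharp_star_iff[OF z(1)] by (intro exI[of _ z]) simp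
  next
    assume ?rep
    then obtain z where z: "\<forall>i. i \<notin> N \<longrightarrow> z $ i = -\<infinity>"
      and z_le1: "ereal (star i j) + z $ j \<le> 1"
      and rep: "ereal_vec x = mp_mat_vec (mp_star (shift_mat A l))
        (mp_add_vec (mp_scal_vec (ereal (1 - l)) 0) z)" for i j
      using le_minplus_sharp_star_iff by blast
    note rep = rep[unfolded mp_star_affine_iff[OF z], rule_format]
    have b_le: "star i j + (1 - l) \<le> x $ i" and z_le: "ereal (star i j) + z $ j \<le> ereal (x $ i)"
      and attained: "\<exists>j. x $ i = star i j + (1 - l) \<or> (j \<in> N \<and> ereal (x $ i) = ereal (star i j) + z $ j)"
      for i j using rep by blast+
    have closed: "star i j + x $ j \<le> x $ i" for i j
    proof -
      obtain k where "x $ j = star j k + (1 - l) \<or> ereal (x $ j) = ereal (star j k) + z $ k"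
        using attained by blast
      then show ?thesis
      proof
        assume "ereal (x $ j) = ereal (star j k) + z $ k"
        then show ?thesis
          using z_le[of i k] star_trans[of i j k] by (cases "z $ k") auto
      qed (use b_le[of i k] star_trans[of i j k] in simp)
    qed
    \<comment> \<open>Wherever \<open>z $ j\<close> attains the maximum it may be replaced by
      \<open>x $ j\<close>: it is at most \<open>x $ j\<close> because \<open>star j j = 0\<close>,
      and \<open>closed\<close> gives the reverse bound.\<close>
    have "\<exists>j. x $ i = star i j + (1 - l) \<or> (j \<in> N \<and> x $ i = star i j + x $ j)" for i
    proof -
      obtain j where "x $ i = star i j + (1 - l) \<or> (j \<in> N \<and> ereal (x $ i) = ereal (star i j) + z $ j)"
        using attained by blast
      moreover have "x $ i = star i j + x $ j" if "ereal (x $ i) = ereal (star i j) + z $ j"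
        using that z_le[of j j] closed[of i j] by (cases "z $ j") auto
      ultimately show ?thesis by blast
    qed
    moreover have "1 - l \<le> x $ i" for i
      using b_le[of i i] by simp
    \<comment> \<open>The constant part is bounded through \<open>star_le\<close>, the part from
      \<open>z\<close> through its min-plus bound.\<close>
    moreover have "x $ i \<le> 1" for i
    proof -
      obtain j where "x $ i = star i j + (1 - l) \<or> ereal (x $ i) = ereal (star i j) + z $ j"
        using attained by blast
      then show ?thesis
      proof
        assume "ereal (x $ i) = ereal (star i j) + z $ j"
        then have "ereal (x $ i) \<le> 1" using z_le1[of i j] by simp
        then show ?thesis by simp
      qed (use star_le[OF nonneg, of i j] in simp)
    qed
    ultimately show "pure_luk_eigenvector A l x"
      unfolding pure_luk_eigenvector_iff[OF \<open>l \<le> 1\<close>] solution_iff using closed by blast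
  qed
qed

end

theorem theorem8:
  fixes A :: "real^'n^'n" and l :: real
  assumes "\<forall>i j. 0 \<le> A $ i $ j \<and> A $ i $ j \<le> 1"
    and "0 \<le> l" and "l \<le> 1"
  shows "((\<exists>x. pure_luk_eigenvector A l x) \<longleftrightarrow>
            max_cycle_mean A \<le> l \<and>
            (MAX i. mp_mat_vec (mp_star (shift_mat A l)) 0 $ i) \<le> ereal l)
       \<and> (max_cycle_mean A \<le> l \<longrightarrow>
            (\<forall>N. is_NC A l N \<longrightarrow>
              (\<forall>x :: real^'n. pure_luk_eigenvector A l x \<longleftrightarrow>
                (\<exists>z :: ereal^'n. (\<forall>i. z $ i \<noteq> \<infinity>) \<and>
                  z \<le> minplus_mat_vec (mp_sharp (mp_star (shift_mat A l))) 1 \<and>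
                  (\<forall>i. i \<notin> N \<longrightarrow> z $ i = -\<infinity>) \<and>
                  ereal_vec x = mp_mat_vec (mp_star (shift_mat A l))
                                  (mp_add_vec (mp_scal_vec (ereal (1 - l)) 0) z))) \<and>
              (l \<noteq> max_cycle_mean A \<longrightarrow>
                (\<forall>z :: ereal^'n. (\<forall>i. z $ i \<noteq> \<infinity>) \<and>
                  z \<le> minplus_mat_vec (mp_sharp (mp_star (shift_mat A l))) 1 \<and>
                  (\<forall>i. i \<notin> N \<longrightarrow> z $ i = -\<infinity>) \<longrightarrow>
                  z = (\<chi> i. -\<infinity>)))))"
proof -
  have nonneg: "\<And>i j. 0 \<le> A $ i $ j"
    using assms(1) by blast
  \<comment> \<open>An eigenvector is a potential for \<open>A\<close> shifted by \<open>l\<close>,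
    which makes every shifted closed walk nonpositive.\<close>
  have le_if_pure: "max_cycle_mean A \<le> l" if "pure_luk_eigenvector A l x" for x
    using that affine_solution_imp_cycle_weight_nonpos
    unfolding max_cycle_mean_le_iff pure_luk_eigenvector_iff[OF \<open>l \<le> 1\<close>] by blast
  have bounded: "bounded_cycle_mean A l" if "max_cycle_mean A \<le> l"
    using that by unfold_locales
  have "z = (\<chi> i. -\<infinity>)"
    if "l \<noteq> max_cycle_mean A" "is_NC A l N" "\<forall>i. i \<notin> N \<longrightarrow> z $ i = -\<infinity>" for N and z :: "ereal^'n"
    using that by (simp add: is_NC_def vec_eq_iff)
  then show ?thesis
    using le_if_pure bounded
      bounded_cycle_mean.pure_luk_eigenvector_exists[OF bounded nonneg \<open>l \<le> 1\<close>]
      bounded_cycle_mean.mp_star_zero_le[OF bounded nonneg]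
      bounded_cycle_mean.pure_luk_eigenvector_star_iff[OF bounded nonneg \<open>l \<le> 1\<close>]
    by blast
qed

end
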